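(* (i) Let $(\vec\psi,\vec M)$ and $(\tilde{\vec\psi},\vec M)$ both satisfy the standing assumptions in the context, where $\tilde\psi_i=\psi_i$ for all $i\neq1$, in the under-saturated or saturated case ($\sum_{i\in I}M_i\le\mu(X)$). Let $\bar P_1$ and $\tilde P_1$ denote the individual values of agent $1$ in the systems $(\vec\psi,\vec M)$ and $(\tilde{\vec\psi},\vec M)$ respectively. If $1<\beta<2$, $\lambda\ge0$ and $$\beta\psi_1(x)\le\tilde\psi_1(x)\le\beta\psi_1(x)+\lambda\qquad\text{for all }x\in X,$$ then $$\tilde P_1\ge\bar P_1-\frac{M_1\lambda(2-\beta)}{\beta-1}.$$ (ii) For any $1<\beta<2$, $\lambda>0$ and $s<\lambda(2-\beta)/(\beta-1)$ there exist such systems $(\vec\psi,\vec M)$ and $(\tilde{\vec\psi},\vec M)$ (both satisfying the standing assumptions, in the under-saturated or saturated case, with $\tilde\psi_i=\psi_i$ for $i\neq1$) with $\beta\psi_1\le\tilde\psi_1\le\beta\psi_1+\lambda$ on $X$, such that $$\tilde P_1<\bar P_1-M_1s .$$ In particular, the inequality in (i) is sharp.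
   Context: Setting. $I=\{1,\ldots,N\}$; $X$ is a compact Hausdorff space; $\mu$ is a probability Borel measure on $X$; $\vec\psi=(\psi_1,\ldots,\psi_N)$ with each $\psi_i:X\to\mathbb R$ continuous ("wisdom" of agent $i$); $\vec M=(M_1,\ldots,M_N)$ with $M_i>0$ ("capacities"). A "system" comprises the choice of all these data. Standing assumptions on a system $(\vec\psi,\vec M)$: (a) $\sum_{i\in I}\mu\{x;\psi_i(x)\le0\}=0$; (b) for any $r\in\mathbb R$ and any $i\ne j\in I$, $\mu\{x;\psi_i(x)-\psi_j(x)=r\}=0$; (c) in the under-saturated case $\sum_{i\in I} M_i<\mu(X)$, additionally $\mu\{x;\psi_i(x)=r\}=0$ for all $i\in I$ and all $r\in\mathbb R$. The saturated case is $\sum_iM_i=\mu(X)$. $\mathcal P_{\vec M}$ is the set of $\vec A=(A_1,\ldots,A_N)$ with $A_i\subset X$ measurable, $\mu(A_i)\le M_i$, and $\mu(A_i\cap A_j)=0$ for $i\ne j$. Under the standing assumptions there is a unique (up to $\mu$-null sets) optimal partition $(\bar A_1,\ldots,\bar A_N)\in\mathcal P_{\vec M}$, i.e. a maximizer of $\vec A\mapsto\sum_{i\in I}\int_{A_i}\psi_i\,d\mu$ over $\mathcal P_{\vec M}$. The individual value of agent $i$ in the system $(\vec\psi,\vec M)$ is $\bar P_i:=\int_{\bar A_i}\psi_i\,d\mu$. Likewise $\tilde P_1$ is $\int\tilde\psi_1\,d\mu$ over agent $1$'s share in the optimal partition of the system $(\tilde{\vec\psi},\vec M)$. *)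

theory Defs
  imports "HOL-Probability.Probability"
begin

text \<open>
  Agents are the natural numbers in \<open>{1..N}\<close>; the values of \<open>\<psi>\<close>, \<open>M\<close> and \<open>A\<close> at other indices
  are irrelevant.  The carrier of \<open>X\<close> is \<open>space \<mu>\<close>, since the \<open>\<sigma>\<close>-algebra of \<open>\<mu>\<close> is the Borel
  \<open>\<sigma>\<close>-algebra of \<open>X\<close>, and \<open>\<mu>\<close> is not required to be regular.
\<close>

definition agent_system ::
    "'a topology \<Rightarrow> 'a measure \<Rightarrow> nat \<Rightarrow> (nat \<Rightarrow> 'a \<Rightarrow> real) \<Rightarrow> (nat \<Rightarrow> real) \<Rightarrow> bool" where
  "agent_system X \<mu> N \<psi> M \<longleftrightarrow>
     compact_space X \<and> Hausdorff_space X \<and>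
     prob_space \<mu> \<and> sets \<mu> = sets (sigma (topspace X) {U. openin X U}) \<and>
     1 \<le> N \<and>
     (\<forall>i\<in>{1..N}. continuous_map X euclideanreal (\<psi> i)) \<and>
     (\<forall>i\<in>{1..N}. 0 < M i)"

definition standing_assumptions ::
    "'a measure \<Rightarrow> nat \<Rightarrow> (nat \<Rightarrow> 'a \<Rightarrow> real) \<Rightarrow> (nat \<Rightarrow> real) \<Rightarrow> bool" where
  "standing_assumptions \<mu> N \<psi> M \<longleftrightarrow>
     (\<Sum>i\<in>{1..N}. measure \<mu> {x \<in> space \<mu>. \<psi> i x \<le> 0}) = 0 \<and>
     (\<forall>r. \<forall>i\<in>{1..N}. \<forall>j\<in>{1..N}. i \<noteq> j \<longrightarrow>
        measure \<mu> {x \<in> space \<mu>. \<psi> i x - \<psi> j x = r} = 0) \<and>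
     ((\<Sum>i\<in>{1..N}. M i) < measure \<mu> (space \<mu>) \<longrightarrow>
        (\<forall>i\<in>{1..N}. \<forall>r. measure \<mu> {x \<in> space \<mu>. \<psi> i x = r} = 0))"

definition partitions :: "'a measure \<Rightarrow> nat \<Rightarrow> (nat \<Rightarrow> real) \<Rightarrow> (nat \<Rightarrow> 'a set) set" where
  "partitions \<mu> N M =
     {A. (\<forall>i\<in>{1..N}. A i \<in> sets \<mu> \<and> measure \<mu> (A i) \<le> M i) \<and>
         (\<forall>i\<in>{1..N}. \<forall>j\<in>{1..N}. i \<noteq> j \<longrightarrow> measure \<mu> (A i \<inter> A j) = 0)}"

definition share_value ::
    "'a measure \<Rightarrow> (nat \<Rightarrow> 'a \<Rightarrow> real) \<Rightarrow> (nat \<Rightarrow> 'a set) \<Rightarrow> nat \<Rightarrow> real" where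
  "share_value \<mu> \<psi> A i = (LINT x:A i|\<mu>. \<psi> i x)"

definition optimal_partition ::
    "'a measure \<Rightarrow> nat \<Rightarrow> (nat \<Rightarrow> 'a \<Rightarrow> real) \<Rightarrow> (nat \<Rightarrow> real) \<Rightarrow> (nat \<Rightarrow> 'a set) \<Rightarrow> bool" where
  "optimal_partition \<mu> N \<psi> M A \<longleftrightarrow>
     A \<in> partitions \<mu> N M \<and>
     (\<forall>B\<in>partitions \<mu> N M.
        (\<Sum>i\<in>{1..N}. share_value \<mu> \<psi> B i) \<le> (\<Sum>i\<in>{1..N}. share_value \<mu> \<psi> A i))"

text \<open>
  The optimal partition is unique only up to null sets, so the individual value is a relation:
  \<open>P\<close> is the value of agent \<open>i\<close>'s share in an optimal partition.  Under
  \<open>agent_system\<close> and \<open>standing_assumptions\<close> exactly one \<open>P\<close> has this property.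
\<close>

definition is_individual_value ::
    "'a measure \<Rightarrow> nat \<Rightarrow> (nat \<Rightarrow> 'a \<Rightarrow> real) \<Rightarrow> (nat \<Rightarrow> real) \<Rightarrow> nat \<Rightarrow> real \<Rightarrow> bool" where
  "is_individual_value \<mu> N \<psi> M i P \<longleftrightarrow>
     (\<exists>A. optimal_partition \<mu> N \<psi> M A \<and> P = share_value \<mu> \<psi> A i)"

text \<open>The systems \<open>(\<psi>, M)\<close> and \<open>(\<psi>', M)\<close> differ only in agent 1.\<close>

definition comparable_systems ::
    "'a topology \<Rightarrow> 'a measure \<Rightarrow> nat \<Rightarrow> (nat \<Rightarrow> 'a \<Rightarrow> real) \<Rightarrow> (nat \<Rightarrow> 'a \<Rightarrow> real) \<Rightarrow>
     (nat \<Rightarrow> real) \<Rightarrow> bool" where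
  "comparable_systems X \<mu> N \<psi> \<psi>' M \<longleftrightarrow>
     agent_system X \<mu> N \<psi> M \<and> standing_assumptions \<mu> N \<psi> M \<and>
     agent_system X \<mu> N \<psi>' M \<and> standing_assumptions \<mu> N \<psi>' M \<and>
     (\<forall>i\<in>{1..N}. i \<noteq> 1 \<longrightarrow> (\<forall>x\<in>topspace X. \<psi>' i x = \<psi> i x)) \<and>
     (\<Sum>i\<in>{1..N}. M i) \<le> measure \<mu> (space \<mu>)"

end

theory Submission imports Defs begin

text \<open>
  Write \<open>d = \<psi>' 1 - \<psi> 1\<close>, and let \<open>A\<close>, \<open>B\<close> be agent 1's shares in the optimal partitions for
  \<open>\<psi>\<close> and \<open>\<psi>'\<close>. Adding the two optimality inequalities cancels all other agents and leaves
  \<open>\<integral>\<^sub>B d \<ge> \<integral>\<^sub>A d\<close>. The bound then follows by integrating a pointwise inequality between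
  \<open>1\<^sub>B \<psi>' 1 - 1\<^sub>A \<psi> 1\<close> and \<open>(1\<^sub>B - 1\<^sub>A) d\<close>.

  The pointwise inequality is tight when \<open>B\<close> is disjoint from \<open>A\<close>, \<open>\<psi> 1 = lam / (\<beta> - 1)\<close> and
  \<open>\<psi>' 1 = \<beta> * \<psi> 1\<close> on \<open>A\<close>, while \<open>\<psi> 1 = 0\<close> and \<open>\<psi>' 1 = lam\<close> on \<open>B\<close>. A small perturbation of this
  configuration on two disjoint intervals, with one competitor whose valuation makes agent 1
  switch intervals, shows sharpness.
\<close>

section \<open>Valuations on a compact space: integrability and positivity\<close>

lemma agent_systemD:
  assumes "agent_system X \<mu> N \<psi> M"
  shows "space \<mu> = topspace X" "prob_space \<mu>" "1 \<in> {1..N}"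
    and "\<And>U. openin X U \<Longrightarrow> U \<in> sets \<mu>"
proof -
  have s: "sets \<mu> = sets (sigma (topspace X) {U. openin X U})"
    using assms by (simp add: agent_system_def)
  show sp: "space \<mu> = topspace X"
    using sets_eq_imp_space_eq[OF s] by (simp add: space_measure_of_conv)
  show "prob_space \<mu>" "1 \<in> {1..N}"
    using assms by (auto simp: agent_system_def)
  have "{U. openin X U} \<subseteq> Pow (topspace X)"
    using openin_subset by blast
  then show "U \<in> sets \<mu>" if "openin X U" for U
    unfolding s using that by (auto intro: sigma_sets.Basic)
qed

text \<open>A continuous function on a compact space is bounded, and it is measurable because every
  open set lies in \<open>sets \<mu>\<close>; on a probability space this suffices.\<close>

lemma agent_system_integrable:
  assumes sys: "agent_system X \<mu> N \<psi> M" and i: "i \<in> {1..N}"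
  shows "integrable \<mu> (\<psi> i)"
proof -
  note [simp] = agent_systemD(1)[OF sys]
  interpret prob_space \<mu>
    by (rule agent_systemD(2)[OF sys])
  have cont: "continuous_map X euclideanreal (\<psi> i)" and comp: "compact_space X"
    using sys i by (auto simp: agent_system_def)
  have meas: "\<psi> i \<in> borel_measurable \<mu>"
  proof (rule borel_measurableI)
    fix S :: "real set" assume "open S"
    then have "openin X {x \<in> topspace X. \<psi> i x \<in> S}"
      using openin_continuous_map_preimage[OF cont] by simp
    moreover have "{x \<in> topspace X. \<psi> i x \<in> S} = \<psi> i -` S \<inter> space \<mu>"
      by auto
    ultimately show "\<psi> i -` S \<inter> space \<mu> \<in> sets \<mu>"
      using agent_systemD(4)[OF sys] by metis
  qed
  have "compactin euclideanreal (\<psi> i ` topspace X)"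
    using image_compactin[OF _ cont] comp by (simp add: compact_space_def)
  then have "bounded (\<psi> i ` topspace X)"
    by (simp add: compact_imp_bounded)
  then obtain B where "\<And>x. x \<in> topspace X \<Longrightarrow> norm (\<psi> i x) \<le> B"
    by (auto simp: bounded_iff)
  then show ?thesis
    by (intro integrable_const_bound[of _ B] meas AE_I2) simp
qed

lemma standing_assumptions_AE_pos:
  assumes sys: "agent_system X \<mu> N \<psi> M" and std: "standing_assumptions \<mu> N \<psi> M"
    and i: "i \<in> {1..N}"
  shows "AE x in \<mu>. 0 < \<psi> i x"
proof -
  interpret prob_space \<mu>
    by (rule agent_systemD(2)[OF sys])
  have [measurable]: "\<psi> i \<in> borel_measurable \<mu>"
    using agent_system_integrable[OF sys i] by simp
  have "measure \<mu> {x \<in> space \<mu>. \<psi> i x \<le> 0} = 0"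
    using std i by (simp add: standing_assumptions_def sum_nonneg_eq_0_iff)
  then have "{x \<in> space \<mu>. \<psi> i x \<le> 0} \<in> null_sets \<mu>"
    by (intro null_setsI) (auto simp: emeasure_eq_measure)
  then show ?thesis
    by (rule AE_I') auto
qed

section \<open>The lower bound: comparing the two optimal shares\<close>

text \<open>There are four cases for membership of \<open>x\<close> in \<open>A\<close> and
  \<open>B\<close>. Outside both, the two sides vanish; in both, \<open>q - p \<ge> 0\<close>
  suffices; in \<open>A\<close> only, the claim is \<open>\<beta> * p \<le> q\<close>. The case of
  \<open>B\<close> only is the one that determines the constant
  \<open>lam * (2 - \<beta>)\<close>.\<close>

lemma share_exchange_bound:
  fixes \<beta> lam p q :: real
  assumes "1 < \<beta>" "\<beta> < 2" "0 \<le> lam" "0 \<le> p" "\<beta> * p \<le> q" "q \<le> \<beta> * p + lam"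
  shows "indicator B x * (q - p) - indicator A x * (q - p) - lam * (2 - \<beta>) * indicator B x
    \<le> (\<beta> - 1) * (indicator B x * q - indicator A x * p)"
proof -
  define d where "d = q - p"
  have q: "q = p + d" and d: "(\<beta> - 1) * p \<le> d" "d \<le> (\<beta> - 1) * p + lam"
    using assms by (auto simp: d_def algebra_simps)
  have d0: "0 \<le> d"
    using d(1) assms mult_nonneg_nonneg[of "\<beta> - 1" p] by linarith
  have l0: "0 \<le> lam * (2 - \<beta>)"
    using assms by simp
  \<comment> \<open>This is the case of \<open>B\<close> only. It amounts to
    \<open>(2 - \<beta>) * (d - lam) \<le> (\<beta> - 1) * p\<close>, hence the split by the sign of
    \<open>d - lam\<close>.\<close>
  have "d - lam * (2 - \<beta>) \<le> (\<beta> - 1) * q"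
  proof (cases "lam \<le> d")
    case True
    then have "0 \<le> (\<beta> - 1) * (d - lam)"
      using assms by simp
    then show ?thesis
      using d(2) by (simp add: q algebra_simps)
  next
    case False
    then have "0 \<le> (2 - \<beta>) * (lam - d)"
      using assms by simp
    moreover have "0 \<le> (\<beta> - 1) * p"
      using assms by simp
    ultimately show ?thesis
      by (simp add: q algebra_simps)
  qed
  moreover have "0 \<le> (\<beta> - 1) * d"
    using d0 assms by simp
  ultimately show ?thesis
    using d d0 l0 by (auto simp: q indicator_def algebra_simps)
qed

lemma individual_value_lower_bound:
  assumes cmp: "comparable_systems X \<mu> N \<psi> \<psi>' M"
    and P: "is_individual_value \<mu> N \<psi> M 1 P"
    and P': "is_individual_value \<mu> N \<psi>' M 1 P'"
    and \<beta>: "1 < \<beta>" "\<beta> < 2" and lam: "0 \<le> lam"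
    and bd: "\<And>x. x \<in> topspace X \<Longrightarrow> \<beta> * \<psi> 1 x \<le> \<psi>' 1 x \<and> \<psi>' 1 x \<le> \<beta> * \<psi> 1 x + lam"
  shows "P' \<ge> P - M 1 * lam * (2 - \<beta>) / (\<beta> - 1)"
proof -
  have sys: "agent_system X \<mu> N \<psi> M" "agent_system X \<mu> N \<psi>' M"
    and std: "standing_assumptions \<mu> N \<psi> M"
    and eq: "\<And>i x. i \<in> {1..N} \<Longrightarrow> i \<noteq> 1 \<Longrightarrow> x \<in> topspace X \<Longrightarrow> \<psi>' i x = \<psi> i x"
    using cmp by (auto simp: comparable_systems_def)
  interpret prob_space \<mu>
    by (rule agent_systemD(2)[OF sys(1)])
  note sp = agent_systemD(1)[OF sys(1)] and one = agent_systemD(3)[OF sys(1)]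
  have int: "integrable \<mu> (\<psi> 1)" "integrable \<mu> (\<psi>' 1)"
    using agent_system_integrable sys one by blast+
  obtain A where A: "optimal_partition \<mu> N \<psi> M A" "P = share_value \<mu> \<psi> A 1"
    using P by (auto simp: is_individual_value_def)
  obtain B where B: "optimal_partition \<mu> N \<psi>' M B" "P' = share_value \<mu> \<psi>' B 1"
    using P' by (auto simp: is_individual_value_def)
  have AB: "A \<in> partitions \<mu> N M" "B \<in> partitions \<mu> N M"
    using A B by (auto simp: optimal_partition_def)
  have sets[measurable]: "A 1 \<in> sets \<mu>" "B 1 \<in> sets \<mu>" and MB: "measure \<mu> (B 1) \<le> M 1"
    using AB one by (auto simp: partitions_def)
  have split: "(\<Sum>i\<in>{1..N}. f i) = f 1 + (\<Sum>i\<in>{1..N} - {1}. f i)" for f :: "nat \<Rightarrow> real"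
    using one by (intro sum.remove) auto
  have rest: "(\<Sum>i\<in>{1..N} - {1}. share_value \<mu> \<psi>' C i) = (\<Sum>i\<in>{1..N} - {1}. share_value \<mu> \<psi> C i)" for C
    unfolding share_value_def set_lebesgue_integral_def
    by (intro sum.cong Bochner_Integration.integral_cong refl) (use eq sp in auto)
  \<comment> \<open>Admissible partitions depend only on \<open>\<mu>\<close>, \<open>N\<close> and
    \<open>M\<close>, so each optimal partition competes in the other system.\<close>
  have "(\<Sum>i\<in>{1..N}. share_value \<mu> \<psi> B i) \<le> (\<Sum>i\<in>{1..N}. share_value \<mu> \<psi> A i)"
    "(\<Sum>i\<in>{1..N}. share_value \<mu> \<psi>' A i) \<le> (\<Sum>i\<in>{1..N}. share_value \<mu> \<psi>' B i)"
    using A B AB by (auto simp: optimal_partition_def)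
  then have exch: "share_value \<mu> \<psi> B 1 + share_value \<mu> \<psi>' A 1
      \<le> share_value \<mu> \<psi> A 1 + share_value \<mu> \<psi>' B 1"
    unfolding split rest by linarith
  have ints: "integrable \<mu> (\<lambda>x. indicator C x * f x)"
    if "C \<in> sets \<mu>" "integrable \<mu> f" for C and f :: "'a \<Rightarrow> real"
    using integrable_mult_indicator[OF that] by simp
  have "(LINT x|\<mu>. indicator (B 1) x * (\<psi>' 1 x - \<psi> 1 x) - indicator (A 1) x * (\<psi>' 1 x - \<psi> 1 x)
        - lam * (2 - \<beta>) * indicator (B 1) x)
      \<le> (LINT x|\<mu>. (\<beta> - 1) * (indicator (B 1) x * \<psi>' 1 x - indicator (A 1) x * \<psi> 1 x))"
  proof (rule integral_mono_AE)
    show "AE x in \<mu>. indicator (B 1) x * (\<psi>' 1 x - \<psi> 1 x) - indicator (A 1) x * (\<psi>' 1 x - \<psi> 1 x)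
        - lam * (2 - \<beta>) * indicator (B 1) x
      \<le> (\<beta> - 1) * (indicator (B 1) x * \<psi>' 1 x - indicator (A 1) x * \<psi> 1 x)"
      using standing_assumptions_AE_pos[OF sys(1) std one] AE_space
      by eventually_elim (use bd \<beta> lam sp in \<open>auto intro!: share_exchange_bound\<close>)
  qed (use int sets in \<open>auto intro!: ints Bochner_Integration.integrable_diff
         simp: emeasure_eq_measure\<close>)
  also have "\<dots> = (\<beta> - 1) * (P' - P)"
    using int sets by (simp add: A B share_value_def set_lebesgue_integral_def ints)
  also have "(LINT x|\<mu>. indicator (B 1) x * (\<psi>' 1 x - \<psi> 1 x) - indicator (A 1) x * (\<psi>' 1 x - \<psi> 1 x)
        - lam * (2 - \<beta>) * indicator (B 1) x)
      = share_value \<mu> \<psi>' B 1 - share_value \<mu> \<psi> B 1 - (share_value \<mu> \<psi>' A 1 - share_value \<mu> \<psi> A 1)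
        - lam * (2 - \<beta>) * measure \<mu> (B 1)"
    using int sets
    by (simp add: share_value_def set_lebesgue_integral_def ints right_diff_distrib emeasure_eq_measure)
  \<comment> \<open>By \<open>exch\<close>, the exchange terms on the left have a nonnegative sum,
    which leaves only the term in \<open>measure \<mu> (B 1)\<close>.\<close>
  finally have "- (lam * (2 - \<beta>) * measure \<mu> (B 1)) \<le> (\<beta> - 1) * (P' - P)"
    using exch by linarith
  moreover have "lam * (2 - \<beta>) * measure \<mu> (B 1) \<le> lam * (2 - \<beta>) * M 1"
    using MB \<beta> lam by (intro mult_left_mono) auto
  ultimately have "- (lam * (2 - \<beta>) * M 1) \<le> (\<beta> - 1) * (P' - P)"
    by linarith
  then show ?thesis
    using \<beta> by (simp add: field_simps)
qed

section \<open>Optimality of two-agent partitions by pricing\<close>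

text \<open>The number \<open>p\<close> is a price for agent 2's capacity (a Lagrange multiplier).\<close>

lemma optimal_partition_two:
  assumes [simp]: "finite_measure \<mu>"
    and A: "A 1 \<in> sets \<mu>" "A 2 = space \<mu> - A 1" "measure \<mu> (A 1) \<le> M 1" "measure \<mu> (A 2) = M 2"
    and int: "integrable \<mu> (\<psi> 1)" "integrable \<mu> (\<psi> 2)"
    and pos: "\<And>x. x \<in> space \<mu> \<Longrightarrow> 0 \<le> \<psi> 1 x"
    and p: "0 \<le> p"
    and le: "\<And>x. x \<in> A 1 \<Longrightarrow> \<psi> 2 x - \<psi> 1 x \<le> p"
    and ge: "\<And>x. x \<in> A 2 \<Longrightarrow> p \<le> \<psi> 2 x - \<psi> 1 x"
  shows "optimal_partition \<mu> 2 \<psi> M A"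
proof -
  interpret finite_measure \<mu> by simp
  have idx: "{1..2::nat} = {1, 2}"
    by auto
  have A2: "A 2 \<in> sets \<mu>"
    using A by auto
  have disj: "A 1 \<inter> A 2 = {}"
    using A by auto
  have ints: "integrable \<mu> (\<lambda>x. indicator C x * f x)"
    if "C \<in> sets \<mu>" "integrable \<mu> f" for C and f :: "'a \<Rightarrow> real"
    using integrable_mult_indicator[OF that] by simp
  define V where "V C = share_value \<mu> \<psi> C 1 + share_value \<mu> \<psi> C 2" for C
  \<comment> \<open>The total value after agent 2 pays \<open>p\<close> per unit of mass.\<close>
  have V: "(LINT x|\<mu>. indicator (C 1) x * \<psi> 1 x + indicator (C 2) x * (\<psi> 2 x - p))
      = V C - p * measure \<mu> (C 2)"
    "integrable \<mu> (\<lambda>x. indicator (C 1) x * \<psi> 1 x + indicator (C 2) x * (\<psi> 2 x - p))"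
    if "C 1 \<in> sets \<mu>" "C 2 \<in> sets \<mu>" for C
    using that int
    by (simp_all add: V_def share_value_def set_lebesgue_integral_def ints right_diff_distrib
        emeasure_eq_measure)
  have "V B \<le> V A"
    if B: "B 1 \<in> sets \<mu>" "B 2 \<in> sets \<mu>" "measure \<mu> (B 2) \<le> M 2" "measure \<mu> (B 1 \<inter> B 2) = 0" for B
  proof -
    have "B 1 \<inter> B 2 \<in> null_sets \<mu>"
      using B by (intro null_setsI) (auto simp: emeasure_eq_measure)
    then have "AE x in \<mu>. x \<notin> B 1 \<inter> B 2"
      by (rule AE_not_in)
    \<comment> \<open>Almost every \<open>x\<close> contributes \<open>\<psi> 1 x\<close>,
      \<open>\<psi> 2 x - p\<close> or \<open>0\<close> on the left, and the largest of these three
      on the right.\<close>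
    then have "AE x in \<mu>. indicator (B 1) x * \<psi> 1 x + indicator (B 2) x * (\<psi> 2 x - p)
        \<le> indicator (A 1) x * \<psi> 1 x + indicator (A 2) x * (\<psi> 2 x - p)"
      using AE_space
    proof eventually_elim
      case (elim x)
      then show ?case
        using pos[of x] le[of x] ge[of x] A(2)
        by (cases "x \<in> A 1"; cases "x \<in> B 1"; cases "x \<in> B 2") auto
    qed
    then have "V B - p * measure \<mu> (B 2) \<le> V A - p * measure \<mu> (A 2)"
      using integral_mono_AE[OF V(2)[of B] V(2)[of A]] V(1)[of B] V(1)[of A] A B A2 by simp
    \<comment> \<open>Complementary slackness: \<open>A 2\<close> exhausts the capacity
      \<open>M 2\<close>, so removing the payments keeps the inequality.\<close>
    moreover have "p * measure \<mu> (B 2) \<le> p * measure \<mu> (A 2)"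
      using p A B by (simp add: mult_left_mono)
    ultimately show ?thesis
      by linarith
  qed
  then show ?thesis
    using A A2 disj
    unfolding optimal_partition_def partitions_def idx V_def by (auto simp: Int_commute)
qed

section \<open>A probability space made of two disjoint intervals\<close>

text \<open>The total length is 1, and the gap allows a continuous function to take unrelated values
  on the two intervals; \<open>step\<close> below jumps at \<open>3/4\<close>, inside the
  gap.\<close>

definition two_blocks :: "real set" where
  "two_blocks = {0..1/2} \<union> {1..3/2}"

definition two_blocks_measure :: "real measure" where
  "two_blocks_measure = restrict_space lborel two_blocks"

definition step :: "real \<Rightarrow> real \<Rightarrow> real \<Rightarrow> real" where
  "step a b x = (if x < 3/4 then a else b)"

text \<open>The parameter \<open>t\<close> is agent 2's premium for the left block. Up to terms in
  \<open>k\<close>, agent 1 receives the left block when \<open>t < a - b\<close> and the right one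
  when \<open>t > a - b\<close>.\<close>

definition duopoly :: "real \<Rightarrow> real \<Rightarrow> real \<Rightarrow> real \<Rightarrow> real \<Rightarrow> nat \<Rightarrow> real \<Rightarrow> real" where
  "duopoly a b t c k i x = (if i = 1 then step a b x else step (t + c) c x + k * x)"

lemma two_blocks_borel[measurable]: "two_blocks \<in> sets borel"
  by (simp add: two_blocks_def)

lemma space_two_blocks_measure[simp]: "space two_blocks_measure = two_blocks"
  by (simp add: two_blocks_measure_def space_restrict_space)

lemma sets_two_blocks_measure:
  "C \<in> sets two_blocks_measure \<longleftrightarrow> C \<in> sets borel \<and> C \<subseteq> two_blocks"
  by (auto simp: two_blocks_measure_def sets_restrict_space_iff)

lemma emeasure_two_blocks_measure:
  "C \<subseteq> two_blocks \<Longrightarrow> emeasure two_blocks_measure C = emeasure lborel C"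
  by (simp add: two_blocks_measure_def emeasure_restrict_space)

lemma measure_two_blocks_measure:
  "C \<subseteq> two_blocks \<Longrightarrow> measure two_blocks_measure C = measure lborel C"
  by (simp add: measure_def emeasure_two_blocks_measure)

lemma measure_two_blocks_halves:
  "measure two_blocks_measure {0..1/2} = 1/2" "measure two_blocks_measure {1..3/2} = 1/2"
  by (simp_all add: measure_two_blocks_measure two_blocks_def)

lemma prob_space_two_blocks_measure: "prob_space two_blocks_measure"
proof
  have "emeasure lborel two_blocks = emeasure lborel {0..1/2::real} + emeasure lborel {1..3/2::real}"
    unfolding two_blocks_def by (intro plus_emeasure[symmetric]) auto
  also have "\<dots> = ennreal (1/2) + ennreal (1/2)"
    by simp
  also have "\<dots> = ennreal (1/2 + 1/2)"
    by (rule ennreal_plus[symmetric]) simp_all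
  finally show "emeasure two_blocks_measure (space two_blocks_measure) = 1"
    by (simp add: emeasure_two_blocks_measure)
qed

text \<open>The trace of a generated sigma-algebra is generated by the traces of its generators,
  here the relatively open sets.\<close>

lemma sets_two_blocks_measure_Borel:
  "sets two_blocks_measure
    = sets (sigma (topspace (top_of_set two_blocks)) {U. openin (top_of_set two_blocks) U})"
proof -
  have "sets two_blocks_measure = sets (restrict_space borel two_blocks)"
    by (auto simp: two_blocks_measure_def sets_restrict_space)
  also have "\<dots> = sigma_sets two_blocks ((\<lambda>U. two_blocks \<inter> U) ` {U. open U})"
    unfolding sets_restrict_space sets_borel
    by (subst restricted_sigma[symmetric]) (use two_blocks_borel in \<open>auto simp: borel_def\<close>)
  also have "(\<lambda>U. two_blocks \<inter> U) ` {U. open U} = {U. openin (top_of_set two_blocks) U}"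
    by (auto simp: openin_open)
  finally show ?thesis
    by (simp add: sets_measure_of_conv) (use openin_imp_subset in blast)
qed

lemma continuous_on_step: "continuous_on two_blocks (step a b)"
proof -
  have "continuous_on ({0..1/2} \<union> {1..3/2}) (step a b)"
  proof (rule continuous_on_closed_Un)
    show "continuous_on {0..1/2} (step a b)"
      by (rule continuous_on_eq[of _ "\<lambda>_. a"]) (auto simp: step_def)
    show "continuous_on {1..3/2} (step a b)"
      by (rule continuous_on_eq[of _ "\<lambda>_. b"]) (auto simp: step_def)
  qed auto
  then show ?thesis
    by (simp add: two_blocks_def)
qed

section \<open>Two-agent systems on the two intervals\<close>

lemma agent_system_duopoly:
  "agent_system (top_of_set two_blocks) two_blocks_measure 2 (duopoly a b t c k) (\<lambda>_. 1/2)"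
proof -
  have "continuous_map (top_of_set two_blocks) euclideanreal (duopoly a b t c k i)" for i
    unfolding continuous_map_iff_continuous duopoly_def
    by (cases "i = 1") (auto intro!: continuous_intros continuous_on_step)
  moreover have "compact two_blocks"
    unfolding two_blocks_def by (intro compact_Un compact_Icc)
  ultimately show ?thesis
    unfolding agent_system_def
    by (auto simp: compact_space_subtopology compactin_subtopology Hausdorff_space_subtopology
        prob_space_two_blocks_measure sets_two_blocks_measure_Borel)
qed

text \<open>The slope \<open>k\<close> serves only to make the level sets of the difference finite.\<close>

lemma standing_assumptions_duopoly:
  assumes pos: "0 < a" "0 < b" "0 < c" "0 < t + c" and k: "0 < k"
  shows "standing_assumptions two_blocks_measure 2 (duopoly a b t c k) (\<lambda>_. 1/2)"
proof -
  have idx: "{1..2::nat} = {1, 2}"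
    by auto
  have duo_pos: "0 < duopoly a b t c k i x" if "x \<in> two_blocks" for i x
    using that pos k by (auto simp: duopoly_def step_def two_blocks_def intro!: add_pos_nonneg)
  have empty: "{x \<in> two_blocks. duopoly a b t c k i x \<le> 0} = {}" for i
    using duo_pos by (auto simp: not_le)
  have nonpos: "measure two_blocks_measure {x \<in> two_blocks. duopoly a b t c k i x \<le> 0} = 0" for i
    unfolding empty by simp
  have null: "measure two_blocks_measure C = 0"
    if "C \<subseteq> two_blocks" "C \<subseteq> {y, z}" for C and y z :: real
  proof -
    have "finite C"
      using that(2) by (rule finite_subset) simp
    then show ?thesis
      using that(1) by (simp add: measure_def emeasure_two_blocks_measure finite_imp_null_set_lborel
          null_setsD1)
  qed
  \<comment> \<open>On each block the difference is affine with slope \<open>- k\<close>, so it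
    takes the value \<open>r\<close> at most once there; the two witnesses solve for
    \<open>x\<close> on the left and on the right.\<close>
  have lev: "measure two_blocks_measure
      {x \<in> two_blocks. duopoly a b t c k 1 x - duopoly a b t c k 2 x = r} = 0" for r
    by (rule null[of _ "(a - t - c - r) / k" "(b - c - r) / k"])
      (use k in \<open>auto simp: duopoly_def step_def field_simps split: if_splits\<close>)
  have swap: "{x \<in> two_blocks. duopoly a b t c k 2 x - duopoly a b t c k 1 x = r}
      = {x \<in> two_blocks. duopoly a b t c k 1 x - duopoly a b t c k 2 x = - r}" for r
    by auto
  have lev': "measure two_blocks_measure
      {x \<in> two_blocks. duopoly a b t c k 2 x - duopoly a b t c k 1 x = r} = 0" for r
    unfolding swap by (rule lev)
  \<comment> \<open>The capacities add up to the total mass 1; in this saturated case agent 1's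
    valuation may be constant on a whole block.\<close>
  show ?thesis
    unfolding standing_assumptions_def idx
    using prob_space.prob_space[OF prob_space_two_blocks_measure] lev lev' nonpos by auto
qed

text \<open>The price criterion with agent 1 on \<open>C\<close> and agent 2 on \<open>D\<close>.
  Both assignments of the blocks are covered because the two systems of the sharpness example use
  opposite ones.\<close>

lemma individual_value_duopoly:
  assumes blocks: "C = {0..1/2} \<and> D = {1..3/2} \<or> C = {1..3/2} \<and> D = {0..1/2}"
    and pos: "0 \<le> a" "0 \<le> b" "0 \<le> p"
    and const: "\<And>x. x \<in> C \<Longrightarrow> step a b x = v"
    and le: "\<And>x. x \<in> C \<Longrightarrow> step (t + c) c x + k * x - step a b x \<le> p"
    and ge: "\<And>x. x \<in> D \<Longrightarrow> p \<le> step (t + c) c x + k * x - step a b x"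
  shows "is_individual_value two_blocks_measure 2 (duopoly a b t c k) (\<lambda>_. 1/2) 1 (v / 2)"
proof -
  interpret prob_space two_blocks_measure
    by (rule prob_space_two_blocks_measure)
  define A where "A i = (if i = (1::nat) then C else D)" for i
  have C: "C \<in> sets two_blocks_measure" "D = two_blocks - C"
    using blocks by (auto simp: sets_two_blocks_measure two_blocks_def)
  have half: "measure two_blocks_measure C = 1/2" "measure two_blocks_measure D = 1/2"
    using blocks measure_two_blocks_halves by auto
  have "optimal_partition two_blocks_measure 2 (duopoly a b t c k) (\<lambda>_. 1/2) A"
  proof (rule optimal_partition_two[of _ _ _ _ p])
    show "integrable two_blocks_measure (duopoly a b t c k 1)"
      "integrable two_blocks_measure (duopoly a b t c k 2)"
      by (auto intro!: agent_system_integrable[OF agent_system_duopoly])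
  qed (use C half pos le ge in \<open>auto simp: A_def duopoly_def step_def finite_measure_axioms\<close>)
  moreover have "share_value two_blocks_measure (duopoly a b t c k) A 1 = v / 2"
  proof -
    have "share_value two_blocks_measure (duopoly a b t c k) A 1
        = (LINT x|two_blocks_measure. indicator C x * v)"
      unfolding share_value_def set_lebesgue_integral_def
      by (intro Bochner_Integration.integral_cong)
        (auto simp: A_def duopoly_def const indicator_def)
    also have "\<dots> = v / 2"
      using C half sets.sets_into_space[OF C(1)] by (simp add: Int_absorb2)
    finally show ?thesis .
  qed
  ultimately show ?thesis
    unfolding is_individual_value_def by metis
qed

section \<open>Sharpness of the bound\<close>

lemma individual_value_lower_bound_sharp:
  fixes \<beta> lam s :: real
  assumes \<beta>: "1 < \<beta>" and lam: "0 < lam" and s: "s < lam * (2 - \<beta>) / (\<beta> - 1)"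
  shows "\<exists>(X :: real topology) \<mu> N \<psi> \<psi>' M P P'.
         comparable_systems X \<mu> N \<psi> \<psi>' M \<and>
         is_individual_value \<mu> N \<psi> M 1 P \<and>
         is_individual_value \<mu> N \<psi>' M 1 P' \<and>
         (\<forall>x\<in>topspace X. \<beta> * \<psi> 1 x \<le> \<psi>' 1 x \<and> \<psi>' 1 x \<le> \<beta> * \<psi> 1 x + lam) \<and>
         P' < P - M 1 * s"
proof -
  \<comment> \<open>\<open>g\<close> is the slack between the bound and \<open>s\<close>, and
    \<open>e\<close> is the perturbation of the extremal configuration. The bound
    \<open>e \<le> g / 3\<close> gives \<open>L - (e + lam) > s\<close>; the second bound on
    \<open>e\<close> keeps \<open>L\<close> positive.\<close>
  define g where "g = lam / (\<beta> - 1) - lam - s"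
  define e where "e = min (g / 3) (lam / (\<beta> - 1) / 2)"
  define L where "L = lam / (\<beta> - 1) - e"
  \<comment> \<open>Chosen so that \<open>\<beta> * L = L + lam - 2 * k\<close>: agent 1's
    preference for the left block drops from \<open>L - e\<close> to \<open>L - e - 2 * k\<close>,
    which leaves room for the slope.\<close>
  define k where "k = (\<beta> - 1) * e / 2"
  \<comment> \<open>The least premium for which, in the second system, agent 2's advantage over
    agent 1 is everywhere at least as large on the left block as on the right.\<close>
  define t where "t = L - e - k / 2"
  \<comment> \<open>Large enough to make agent 2's valuation positive and both prices,
    \<open>c - e\<close> and \<open>c + t - \<beta> * L\<close>, nonnegative.\<close>
  define c where "c = \<beta> * L + e + k"
  have "lam * (2 - \<beta>) / (\<beta> - 1) = lam / (\<beta> - 1) - lam"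
    using \<beta> by (simp add: field_simps)
  then have g: "0 < g"
    using s by (simp add: g_def)
  have q: "0 < lam / (\<beta> - 1)"
    using \<beta> lam by simp
  have "0 < min (u / 3) (v / 2) \<and> 3 * min (u / 3) (v / 2) \<le> u \<and> 2 * min (u / 3) (v / 2) \<le> v"
    if "0 < u" "0 < v" for u v :: real
    using that by (auto simp: min_def)
  from this[OF g q] have e: "0 < e" "3 * e \<le> g" "2 * e \<le> lam / (\<beta> - 1)"
    by (simp_all add: e_def)
  have L: "0 < L" "e + lam + s < L"
    using e q by (auto simp: L_def g_def)
  have k: "0 < k"
    using e \<beta> by (simp add: k_def)
  have L_eq: "\<beta> * L = L + lam - 2 * k"
    using \<beta> by (simp add: L_def k_def field_simps)
  have eb: "\<beta> * e \<le> e + lam" "k \<le> lam / 4"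
    using \<beta> e lam by (auto simp: field_simps k_def)
  have bL: "L < \<beta> * L" "0 < \<beta> * L"
    using \<beta> L by simp_all
  have c: "0 < c" "0 < t + c" "0 \<le> c - e" "0 \<le> c + t - \<beta> * L"
    using L e k bL unfolding c_def t_def by linarith+
  define \<psi> where "\<psi> = duopoly L e t c k"
  define \<psi>' where "\<psi>' = duopoly (\<beta> * L) (e + lam) t c k"
  define M where "M = (\<lambda>_::nat. 1/2 :: real)"
  have "comparable_systems (top_of_set two_blocks) two_blocks_measure 2 \<psi> \<psi>' M"
    unfolding comparable_systems_def \<psi>_def \<psi>'_def M_def
    using L e lam c k \<beta> prob_space.prob_space[OF prob_space_two_blocks_measure]
    by (auto intro!: agent_system_duopoly standing_assumptions_duopoly simp: duopoly_def)
  \<comment> \<open>Agent 1 holds the left block; the price is the maximum there of agent 2's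
    advantage, attained at \<open>x = 1/2\<close>.\<close>
  moreover have "is_individual_value two_blocks_measure 2 \<psi> M 1 (L / 2)"
    unfolding \<psi>_def M_def
  proof (rule individual_value_duopoly[of "{0..1/2}" "{1..3/2}" _ _ "c - e"])
    fix x :: real
    show "step (t + c) c x + k * x - step L e x \<le> c - e" if "x \<in> {0..1/2}"
      using that mult_left_mono[of x "1/2" k] k by (auto simp: step_def t_def)
    show "c - e \<le> step (t + c) c x + k * x - step L e x" if "x \<in> {1..3/2}"
      using that k by (auto simp: step_def)
  qed (use L e c in \<open>auto simp: step_def\<close>)
  \<comment> \<open>Agent 1 now holds the right block. The price is agent 2's advantage at
    \<open>x = 0\<close>, and by the choice of \<open>t\<close> it equals the maximum on the right
    block, attained at \<open>x = 3/2\<close>.\<close>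
  moreover have "is_individual_value two_blocks_measure 2 \<psi>' M 1 ((e + lam) / 2)"
    unfolding \<psi>'_def M_def
  proof (rule individual_value_duopoly[of "{1..3/2}" "{0..1/2}" _ _ "c + t - \<beta> * L"])
    fix x :: real
    show "step (t + c) c x + k * x - step (\<beta> * L) (e + lam) x \<le> c + t - \<beta> * L" if "x \<in> {1..3/2}"
      using that mult_left_mono[of x "3/2" k] k L_eq by (auto simp: step_def t_def)
    show "c + t - \<beta> * L \<le> step (t + c) c x + k * x - step (\<beta> * L) (e + lam) x" if "x \<in> {0..1/2}"
      using that k by (auto simp: step_def)
  qed (use L e c lam bL in \<open>auto simp: step_def\<close>)
  moreover have "\<forall>x\<in>topspace (top_of_set two_blocks). \<beta> * \<psi> 1 x \<le> \<psi>' 1 x \<and> \<psi>' 1 x \<le> \<beta> * \<psi> 1 x + lam"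
    using lam \<beta> e eb bL by (auto simp: \<psi>_def \<psi>'_def duopoly_def step_def)
  moreover have "(e + lam) / 2 < L / 2 - M 1 * s"
    using L by (simp add: M_def)
  ultimately show ?thesis
    by blast
qed

theorem theorem4:
  "(\<forall>(X :: 'a topology) \<mu> N \<psi> \<psi>' M \<beta> lam P P'.
      comparable_systems X \<mu> N \<psi> \<psi>' M \<longrightarrow>
      is_individual_value \<mu> N \<psi> M 1 P \<longrightarrow>
      is_individual_value \<mu> N \<psi>' M 1 P' \<longrightarrow>
      1 < \<beta> \<longrightarrow> \<beta> < 2 \<longrightarrow> 0 \<le> lam \<longrightarrow>
      (\<forall>x\<in>topspace X. \<beta> * \<psi> 1 x \<le> \<psi>' 1 x \<and> \<psi>' 1 x \<le> \<beta> * \<psi> 1 x + lam) \<longrightarrow>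
      P' \<ge> P - M 1 * lam * (2 - \<beta>) / (\<beta> - 1))
   \<and>
   (\<forall>\<beta> lam s :: real.
      1 < \<beta> \<longrightarrow> \<beta> < 2 \<longrightarrow> 0 < lam \<longrightarrow> s < lam * (2 - \<beta>) / (\<beta> - 1) \<longrightarrow>
      (\<exists>(X :: real topology) \<mu> N \<psi> \<psi>' M P P'.
         comparable_systems X \<mu> N \<psi> \<psi>' M \<and>
         is_individual_value \<mu> N \<psi> M 1 P \<and>
         is_individual_value \<mu> N \<psi>' M 1 P' \<and>
         (\<forall>x\<in>topspace X. \<beta> * \<psi> 1 x \<le> \<psi>' 1 x \<and> \<psi>' 1 x \<le> \<beta> * \<psi> 1 x + lam) \<and>
         P' < P - M 1 * s))"
proof (rule conjI, goal_cases)
  case 1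
  show ?case
    by (blast intro: individual_value_lower_bound)
next
  case 2
  show ?case
    by (blast intro: individual_value_lower_bound_sharp)
qed

end
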